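(* Let $d\ge 1$ be an integer. There exist an isometry invariant $\sigma$-algebra $\mathcal{A}$ of subsets of $\mathbb{R}^d$ containing all Borel subsets of $\mathbb{R}^d$, and an isometry invariant $\sigma$-finite measure $\mu$ defined on $\mathcal{A}$, such that the restriction of $\mu$ to the Borel subsets of $\mathbb{R}^d$ is not $\sigma$-finite.
   Context: $\mathrm{Isom}(\mathbb{R}^d)$ is the group of isometries of $\mathbb{R}^d$. A $\sigma$-algebra $\mathcal{A}$ of subsets of $\mathbb{R}^d$ is isometry invariant if $\varphi(A)\in\mathcal{A}$ for every $A\in\mathcal{A}$ and every $\varphi\in\mathrm{Isom}(\mathbb{R}^d)$. A measure $\mu$ on such an $\mathcal{A}$ is isometry invariant if $\mu(\varphi(A))=\mu(A)$ for every $A\in\mathcal{A}$ and every $\varphi\in\mathrm{Isom}(\mathbb{R}^d)$. The measure $\mu$ is $\sigma$-finite if $\mathbb{R}^d$ is a countable union of members of $\mathcal{A}$ (not necessarily Borel sets) of finite $\mu$-measure; its restriction to the Borel sets is $\sigma$-finite if $\mathbb{R}^d$ is a countable union of Borel sets of finite $\mu$-measure. Measures take values in $[0,\infty]$. *)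

theory Defs
  imports "HOL-Analysis.Analysis" "HOL-Probability.Conditional_Expectation"
begin

definition Isom :: "('a::metric_space \<Rightarrow> 'a) set" where
  "Isom = {\<phi>. bij \<phi> \<and> (\<forall>x y. dist (\<phi> x) (\<phi> y) = dist x y)}"

definition isometry_invariant_sets :: "'a::metric_space set set \<Rightarrow> bool" where
  "isometry_invariant_sets \<A> \<longleftrightarrow> (\<forall>A\<in>\<A>. \<forall>\<phi>\<in>Isom. \<phi> ` A \<in> \<A>)"

(* Only meaningful when sets M is isometry invariant: emeasure is 0 outside sets M. *)
definition isometry_invariant_measure :: "'a::metric_space measure \<Rightarrow> bool" where
  "isometry_invariant_measure M \<longleftrightarrow>
     (\<forall>A\<in>sets M. \<forall>\<phi>\<in>Isom. emeasure M (\<phi> ` A) = emeasure M A)"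

end

theory Submission
  imports Defs
begin

text \<open>Colour $\mathbb{R}^d$ with countably many colours such that every isometry preserves the
  colour of all but fewer than continuum many points, while every colour class meets every
  uncountable closed set in continuum many points. Call a set small if it has fewer than continuum
  many points; by Koenig's theorem the small sets form a sigma-ideal. Modulo this ideal, consider
  the sets that agree on each colour class with some Borel set (depending on the class) and let
  the measure be the sum of the Lebesgue measures of these Borel sets. Each colour class carries a
  copy of Lebesgue measure, so the measure is sigma-finite, but a Borel set of positive Lebesgue
  measure has positive measure in each of infinitely many classes, hence infinite measure.

  The colouring is obtained by a transfinite recursion of length continuum: at stage $j$ choose a
  point $p_j$ of the $j$-th closed set outside the orbits of all earlier points under the group
  generated by the first $j$ isometries, and give one colour to the orbit of $p_j$ under that
  group. The $i$-th isometry then moves only points of the first $i$ orbits to another colour.\<close>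

section \<open>Sets of fewer than continuum many points\<close>

unbundle cardinal_syntax

text \<open>The continuum is represented by the power set of the naturals, so that
  \<open>nat set\<close> can later index the transfinite recursion.\<close>

abbreviation small :: "'a set \<Rightarrow> bool" where
  "small A \<equiv> |A| <o |UNIV :: nat set set|"

lemma small_subset:
  assumes "small A" "B \<subseteq> A"
  shows "small B"
  using ordLeq_ordLess_trans[OF card_of_mono1[OF assms(2)] assms(1)] .

lemma small_image:
  assumes "small A"
  shows "small (f ` A)"
  using ordLeq_ordLess_trans[OF card_of_image assms] .

lemma small_empty: "small {}"
  using card_of_ordLess2[of "UNIV :: nat set set" "{}"] by auto

text \<open>Koenig's diagonal argument: split each set of naturals into countably many rows. If
  \<open>h\<close> mapped the union onto all sets of naturals, the \<open>n\<close>-th rows coming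
  from \<open>E n\<close> would still miss some \<open>Y n\<close>, and the set with rows
  \<open>Y n\<close> would have no preimage.\<close>

lemma small_UN_nat:
  fixes E :: "nat \<Rightarrow> 'a set"
  assumes "\<And>n. small (E n)"
  shows "small (\<Union>n. E n)"
proof (rule ccontr)
  assume "\<not> small (\<Union>n. E n)"
  then obtain h :: "'a \<Rightarrow> nat set" where h: "h ` (\<Union>n. E n) = UNIV"
    using card_of_ordLess2[of "UNIV :: nat set set" "\<Union>n. E n"] by auto
  define row where "row n x = {k. prod_encode (n, k) \<in> h x}" for n x
  have "\<exists>Y. Y \<notin> row n ` E n" for n
  proof (rule ccontr)
    assume "\<nexists>Y. Y \<notin> row n ` E n"
    then have "row n ` E n = UNIV" by blast
    then show False
      using card_of_ordLess2[of "UNIV :: nat set set" "E n"] assms[of n] by auto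
  qed
  then obtain Y where Y: "\<And>n. Y n \<notin> row n ` E n" by metis
  define Z where "Z = {m. snd (prod_decode m) \<in> Y (fst (prod_decode m))}"
  obtain x m where x: "x \<in> E m" "h x = Z"
    using h by (metis UNIV_I UN_E image_iff)
  have "row m x = Y m"
    unfolding row_def x(2) Z_def by simp
  with x(1) Y[of m] show False by blast
qed

lemma infinite_nat_set: "infinite (UNIV :: nat set set)"
  by (simp add: Finite_Set.finite_set)

lemma small_Un:
  assumes "small A" "small B"
  shows "small (A \<union> B)"
  by (rule card_of_Un_ordLess_infinite[OF infinite_nat_set assms])

section \<open>Cardinalities of closed sets and of the isometry group\<close>

lemma card_of_closed_sets:
  "|{S :: 'a::second_countable_topology set. closed S}| \<le>o |UNIV :: nat set set|"
proof -
  obtain B :: "'a set set" where B: "countable B" "topological_basis B"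
    using ex_countable_basis by blast
  \<comment> \<open>A closed set is determined by the basic open sets inside its complement, hence
    by their codes in a countable basis.\<close>
  define F where "F S = to_nat_on B ` {U \<in> B. U \<subseteq> - S}" for S
  have "inj_on F {S. closed S}"
  proof (rule inj_onI)
    fix S S' assume *: "S \<in> {S. closed S}" "S' \<in> {S. closed S}" "F S = F S'"
    have "{U \<in> B. U \<subseteq> - S} = {U \<in> B. U \<subseteq> - S'}"
      using *(3) inj_on_image_eq_iff[OF inj_on_to_nat_on[OF B(1)]]
      unfolding F_def by blast
    moreover have "- W = \<Union>{U \<in> B. U \<subseteq> - W}" if "closed W" for W
      using that topological_basisE[OF B(2), of "- W"] by (fastforce simp: open_Compl)
    ultimately show "S = S'"
      using *(1,2) by (metis mem_Collect_eq double_complement)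
  qed
  then show ?thesis
    using card_of_ordLeq[of "{S :: 'a set. closed S}" "UNIV :: nat set set"] by blast
qed

lemma Isom_continuous_on: "\<phi> \<in> Isom \<Longrightarrow> continuous_on S \<phi>"
  unfolding Isom_def continuous_on_iff by auto

text \<open>An isometry is continuous, hence determined by its graph, which is closed in the product
  space.\<close>

lemma card_of_Isom:
  "|Isom :: ('a::euclidean_space \<Rightarrow> 'a) set| \<le>o |UNIV :: nat set set|"
proof -
  let ?graph = "\<lambda>\<phi> :: 'a \<Rightarrow> 'a. range (\<lambda>x. (x, \<phi> x))"
  have "inj_on ?graph Isom"
    by (rule inj_onI) (auto simp: fun_eq_iff image_def set_eq_iff)
  moreover have "?graph ` Isom \<subseteq> {S. closed S}"
    using continuous_closed_graph[OF closed_UNIV Isom_continuous_on] by blast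
  ultimately have "|Isom :: ('a \<Rightarrow> 'a) set| \<le>o |{S :: ('a \<times> 'a) set. closed S}|"
    using card_of_ordLeq by blast
  then show ?thesis
    using card_of_closed_sets ordLeq_transitive by blast
qed

lemma Isom_inv: "\<phi> \<in> Isom \<Longrightarrow> inv \<phi> \<in> Isom"
  unfolding Isom_def by (auto simp: bij_imp_bij_inv) (metis bij_inv_eq_iff)

text \<open>Cantor-Bendixson: deleting every basic open set that meets \<open>K\<close> in a
  countable set removes only countably many points of \<open>K\<close> and leaves a nonempty perfect
  set, which has at least continuum many points.\<close>

lemma card_of_uncountable_closed:
  fixes K :: "'a::euclidean_space set"
  assumes "closed K" "uncountable K"
  shows "|UNIV :: nat set set| \<le>o |K|"
proof -
  obtain B :: "'a set set" where B: "countable B" "topological_basis B"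
    using ex_countable_basis by blast
  define C where "C = \<Union>{U \<in> B. countable (K \<inter> U)}"
  define S where "S = K - C"
  have count: "countable (K \<inter> C)"
  proof -
    have "K \<inter> C = (\<Union>U\<in>{U \<in> B. countable (K \<inter> U)}. K \<inter> U)"
      unfolding C_def by blast
    moreover have "countable \<dots>"
      using B(1) by (intro countable_UN) auto
    ultimately show ?thesis by simp
  qed
  have "open C"
    unfolding C_def using topological_basis_open[OF B(2)] by auto
  then have "closed S"
    unfolding S_def using assms(1) by blast
  have "uncountable S"
  proof
    assume "countable S"
    then have "countable (S \<union> K \<inter> C)" using count by simp
    moreover have "S \<union> K \<inter> C = K" unfolding S_def by blast
    ultimately show False using assms(2) by simp
  qed
  have limpt: "x islimpt S" if "x \<in> S" for x
  proof (rule islimptI)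
    fix T assume "x \<in> T" "open T"
    then obtain U where U: "U \<in> B" "x \<in> U" "U \<subseteq> T"
      using topological_basisE[OF B(2)] by metis
    have "uncountable (K \<inter> U)"
      using U that unfolding S_def C_def by blast
    have "uncountable (S \<inter> U)"
    proof
      assume "countable (S \<inter> U)"
      then have "countable ((S \<inter> U) \<union> (K \<inter> C))" using count by simp
      then have "countable (K \<inter> U)"
        by (rule countable_subset[rotated]) (auto simp: S_def)
      with \<open>uncountable (K \<inter> U)\<close> show False by simp
    qed
    then have "\<not> S \<inter> U \<subseteq> {x}"
      by (metis countable_empty countable_insert countable_subset)
    then show "\<exists>y\<in>S. y \<in> T \<and> y \<noteq> x" using U by blast
  qed
  have "x \<in> euclidean derived_set_of S \<longleftrightarrow> x islimpt S" for x
    unfolding in_derived_set_of islimpt_def by auto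
  then have "euclidean derived_set_of S = S"
    using limpt \<open>closed S\<close> unfolding closed_limpt by blast
  moreover have "S \<noteq> {}"
    using \<open>uncountable S\<close> by auto
  ultimately have "(UNIV :: real set) \<lesssim> S"
    using completely_metrizable_space_euclidean by (intro lepoll_perfect_set[of euclidean]) auto
  also have "S \<lesssim> K" unfolding S_def by (simp add: subset_imp_lepoll)
  finally have "(UNIV :: nat set set) \<lesssim> K"
    using nat_sets_eqpoll_reals lepoll_trans1 by blast
  then show ?thesis
    unfolding lepoll_def using card_of_ordLeq by blast
qed

section \<open>Cardinal bounds for reachable sets\<close>

lemma finite_ordLeq_infinite:
  assumes "finite A" "infinite B"
  shows "|A| \<le>o |B|"
  using finite_lepoll_infinite[OF assms(2,1)] card_of_ordLeq unfolding lepoll_def by blast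

lemma card_of_Un_ordLeq_infinite:
  assumes "infinite C" "|A| \<le>o |C|" "|B| \<le>o |C|"
  shows "|A \<union> B| \<le>o |C|"
  by (rule card_of_Un_ordLeq_infinite_Field[of "|C|", unfolded Field_card_of,
        OF assms card_of_card_order_on])

text \<open>The reachable set is a countable union of iterated images, and an infinite cardinal
  absorbs unions of that many sets of at most that size. It will bound the orbits.\<close>

lemma card_of_rtrancl_Image:
  assumes "infinite T" "\<And>u. |R `` {u}| \<le>o |T|"
  shows "|R\<^sup>* `` {y}| \<le>o |T|"
proof -
  have step: "|(R ^^ n) `` {y}| \<le>o |T|" for n
  proof (induction n)
    case 0
    have "T \<noteq> {}" using assms(1) by auto
    then show ?case
      by (simp add: card_of_singl_ordLeq)
  next
    case (Suc n)
    have "(R ^^ Suc n) `` {y} = (\<Union>u\<in>(R ^^ n) `` {y}. R `` {u})"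
      by auto
    then show ?case
      using card_of_UNION_ordLeq_infinite[OF assms(1) Suc] assms(2) by metis
  qed
  have "R\<^sup>* `` {y} = (\<Union>n\<in>(UNIV :: nat set). (R ^^ n) `` {y})"
    by (auto simp: rtrancl_is_UN_relpow)
  moreover have "|UNIV :: nat set| \<le>o |T|"
    using assms(1) infinite_iff_card_of_nat by blast
  ultimately show ?thesis
    using card_of_UNION_ordLeq_infinite[OF assms(1), of UNIV] step by metis
qed

section \<open>Almost invariant colourings\<close>

text \<open>The recursion in purely set-theoretic form: stage \<open>j\<close> picks
  \<open>p j\<close> in \<open>K j\<close> and gives it the colour \<open>col j\<close>. Injectivity
  of \<open>p\<close> turns repeated requests into distinct points.\<close>

lemma invariant_colouring:
  fixes g :: "'k \<Rightarrow> 'a \<Rightarrow> 'a" and K :: "'k \<Rightarrow> 'a set" and col :: "'k \<Rightarrow> nat"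
  assumes unc: "uncountable (UNIV :: 'k set)"
    and bij: "\<And>i. bij (g i)"
    and K: "\<And>j. |UNIV :: 'k set| \<le>o |K j|"
  obtains f p where "inj p" "\<And>j. p j \<in> K j" "\<And>j. f (p j) = col j"
    "\<And>i. |{x. f (g i x) \<noteq> f x}| <o |UNIV :: 'k set|"
proof -
  \<comment> \<open>The cardinal of the index type is a well-order of minimal length, so it provides
    the order of the stages: each \<open>underS r j\<close> is smaller than the whole type.\<close>
  define r where "r = |UNIV :: 'k set|"
  have inf: "infinite (UNIV :: 'k set)"
    using unc countable_finite by blast
  have card: "Card_order r"
    unfolding r_def by (rule card_of_Card_order)
  have Field: "Field r = UNIV"
    unfolding r_def by (rule Field_card_of)
  have wo: "Well_order r"
    unfolding r_def by (rule card_of_Well_order)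
  have refl: "(i, i) \<in> r" and total: "i \<noteq> j \<Longrightarrow> (i, j) \<in> r \<or> (j, i) \<in> r"
    and antisym: "(i, j) \<in> r \<Longrightarrow> (j, i) \<in> r \<Longrightarrow> i = j"
    and trans: "(i, j) \<in> r \<Longrightarrow> (j, k) \<in> r \<Longrightarrow> (i, k) \<in> r" for i j k
    using wo Field
    unfolding well_order_on_def linear_order_on_def partial_order_on_def preorder_on_def
    by (auto simp: refl_on_def total_on_def dest: antisymD transD)
  have wf: "wf (r - Id)"
    using wo by (simp add: well_order_on_def)
  have underS_iff: "i \<in> underS r j \<longleftrightarrow> (i, j) \<in> r - Id" for i j
    by (auto simp: underS_def)

  \<comment> \<open>Symmetry of \<open>R j\<close> supplies the inverses, so \<open>orb j x\<close>
    is the orbit of \<open>x\<close> under the group generated by the \<open>g i\<close> with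
    \<open>i\<close> before \<open>j\<close>.\<close>
  define R where "R j = {(u, v). \<exists>i\<in>underS r j. v = g i u \<or> u = g i v}" for j
  define orb where "orb j x = (R j)\<^sup>* `` {x}" for j x
  have sym: "sym (R j)" for j
    by (auto simp: sym_def R_def)
  have orb_sym: "y \<in> orb j x \<longleftrightarrow> x \<in> orb j y" for j x y
    using sym_rtrancl[OF sym[of j]] unfolding orb_def sym_def by blast
  have orb_trans: "y \<in> orb j x \<Longrightarrow> z \<in> orb j y \<Longrightarrow> z \<in> orb j x" for j x y z
    unfolding orb_def by (auto intro: rtrancl_trans)
  have orb_mono: "orb i x \<subseteq> orb j x" if "(i, j) \<in> r" for i j x
  proof -
    have "underS r i \<subseteq> underS r j"
      using that trans antisym unfolding underS_def by blast
    then have "R i \<subseteq> R j" unfolding R_def by blast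
    then show ?thesis unfolding orb_def using rtrancl_mono by blast
  qed
  have orb_g: "g i x \<in> orb j y \<longleftrightarrow> x \<in> orb j y" if "i \<in> underS r j" for i j x y
  proof -
    have "(x, g i x) \<in> R j" "(g i x, x) \<in> R j"
      using that unfolding R_def by blast+
    then show ?thesis
      unfolding orb_def by (auto intro: rtrancl_into_rtrancl)
  qed

  \<comment> \<open>Adding the naturals makes the cardinal bounds uniform, as \<open>underS r j\<close> may be finite.\<close>
  define T where "T j = underS r j <+> (UNIV :: nat set)" for j
  have inf_T: "infinite (T j)" for j
    unfolding T_def by simp
  have T_less: "|T j| <o |UNIV :: 'k set|" for j
    unfolding T_def
  proof (rule card_of_Plus_ordLess_infinite[OF inf])
    show "|underS r j| <o |UNIV :: 'k set|"
      using card_of_underS[OF card, of j] Field unfolding r_def by simp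
    show "|UNIV :: nat set| <o |UNIV :: 'k set|"
      using unc uncountable_def
      by (metis UNIV_not_empty card_of_ordLess2)
  qed
  have underS_le: "|underS r j| \<le>o |T j|" for j
    unfolding T_def by (rule card_of_Plus1)
  have orb_le: "|orb j x| \<le>o |T j|" for j x
    unfolding orb_def
  proof (rule card_of_rtrancl_Image[OF inf_T])
    fix u
    have "R j `` {u} \<subseteq> (\<Union>i\<in>underS r j. {g i u, inv (g i) u})"
      unfolding R_def using bij by (auto simp: bij_def)
    moreover have "|\<Union>i\<in>underS r j. {g i u, inv (g i) u}| \<le>o |T j|"
    proof (rule card_of_UNION_ordLeq_infinite[OF inf_T underS_le], rule ballI)
      fix i show "|{g i u, inv (g i) u}| \<le>o |T j|"
        using inf_T by (intro finite_ordLeq_infinite) auto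
    qed
    ultimately show "|R j `` {u}| \<le>o |T j|"
      by (rule ordLeq_transitive[OF card_of_mono1])
  qed
  have orbs_le: "|\<Union>i\<in>underS r j. orb j (q i)| \<le>o |T j|" for j q
    by (rule card_of_UNION_ordLeq_infinite[OF inf_T underS_le]) (use orb_le in blast)

  \<comment> \<open>\<open>P q j\<close> consults \<open>q\<close> only before \<open>j\<close>, as
    well-founded choice demands. The forbidden orbits of earlier points are taken under the group of
    stage \<open>j\<close>; together they are too few to cover \<open>K j\<close>.\<close>
  define P where "P q j x \<longleftrightarrow> x \<in> K j \<and> x \<notin> (\<Union>i\<in>underS r j. orb j (q i))" for q j x
  have "\<exists>q. \<forall>j. P q j (q j)"
  proof (rule dependent_wf_choice[OF wf])
    show "P q j x = P q' j x" if "\<And>i. (i, j) \<in> r - Id \<Longrightarrow> q i = q' i" for q q' j x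
      unfolding P_def using that by (auto simp: underS_iff)
    show "\<exists>x. P q j x" for q j
    proof (rule ccontr)
      assume "\<nexists>x. P q j x"
      then have "K j \<subseteq> (\<Union>i\<in>underS r j. orb j (q i))"
        unfolding P_def by blast
      from ordLeq_transitive[OF K ordLeq_transitive[OF card_of_mono1[OF this] orbs_le]]
      show False
        using T_less[of j] not_ordLess_ordLeq by blast
    qed
  qed
  then obtain p where p: "\<And>j. p j \<in> K j"
    "\<And>i j. i \<in> underS r j \<Longrightarrow> p j \<notin> orb j (p i)"
    unfolding P_def by blast
  have self: "p j \<in> orb j (p j)" for j
    unfolding orb_def by blast
  \<comment> \<open>Since \<open>orb i (p i)\<close> lies in \<open>orb j (p i)\<close>, a common
    point would put \<open>p j\<close> into that forbidden orbit.\<close>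
  have disj_less: "orb i (p i) \<inter> orb j (p j) = {}" if "i \<in> underS r j" for i j
  proof -
    have "(i, j) \<in> r" using that by (simp add: underS_def)
    then show ?thesis
      using p(2)[OF that] orb_mono orb_sym orb_trans by blast
  qed
  have disj: "i = j" if "x \<in> orb i (p i)" "x \<in> orb j (p j)" for i j x
    using that disj_less[of i j] disj_less[of j i] total[of i j]
    unfolding underS_def by blast
  \<comment> \<open>Disjointness of the orbits makes \<open>THE\<close> well defined; points in no
    orbit get the default colour 0.\<close>
  define f where "f x = (if \<exists>j. x \<in> orb j (p j) then col (THE j. x \<in> orb j (p j)) else 0)" for x
  have f_eq: "f x = col j" if "x \<in> orb j (p j)" for x j
  proof -
    have "(THE j. x \<in> orb j (p j)) = j"
      using that disj by blast
    then show ?thesis using that unfolding f_def by auto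
  qed
  have f_0: "f x = 0" if "\<And>j. x \<notin> orb j (p j)" for x
    using that unfolding f_def by auto
  show thesis
  proof
    show "inj p"
      using disj self by (metis injI)
    show "p j \<in> K j" for j by (rule p)
    show "f (p j) = col j" for j using f_eq[OF self] .
    show "|{x. f (g i x) \<noteq> f x}| <o |UNIV :: 'k set|" for i
    proof -
      \<comment> \<open>Outside \<open>E\<close> neither \<open>x\<close> nor \<open>g i x\<close>
        lies in an orbit of stage at most \<open>i\<close>, while the orbits of later stages are
        closed under \<open>g i\<close> and its inverse. So \<open>x\<close> and
        \<open>g i x\<close> lie in the same orbits.\<close>
      define E where "E = (\<Union>j\<in>insert i (underS r i). orb j (p j) \<union> inv (g i) ` orb j (p j))"
      have "{x. f (g i x) \<noteq> f x} \<subseteq> E"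
      proof (rule ccontr)
        assume "\<not> {x. f (g i x) \<noteq> f x} \<subseteq> E"
        then obtain x where x: "f (g i x) \<noteq> f x" "x \<notin> E" by blast
        have "inv (g i) (g i x) = x" using bij by (simp add: bij_def)
        then have x': "x \<notin> orb j (p j)" "g i x \<notin> orb j (p j)" if "j \<in> insert i (underS r i)" for j
          using x(2) that unfolding E_def by (fastforce simp: image_iff)+
        have "x \<in> orb j (p j) \<longleftrightarrow> g i x \<in> orb j (p j)" for j
        proof (cases "j \<in> insert i (underS r i)")
          case True
          then show ?thesis using x' by blast
        next
          case False
          then have "i \<in> underS r j"
            using total unfolding underS_def by blast
          then show ?thesis using orb_g by blast
        qed
        then have "f (g i x) = f x"
          using f_eq f_0 by metis
        with x(1) show False by simp
      qed
      then have "|{x. f (g i x) \<noteq> f x}| \<le>o |E|"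
        by (rule card_of_mono1)
      also have "|E| \<le>o |T i|"
        unfolding E_def
      proof (rule card_of_UNION_ordLeq_infinite[OF inf_T], goal_cases)
        case 1
        show ?case
          using card_of_Un_ordLeq_infinite[OF inf_T underS_le, of "{i}" i]
            finite_ordLeq_infinite[of "{i}" "T i"] inf_T
          by (metis Un_insert_right finite.emptyI finite.insertI sup_bot_right)
      next
        case 2
        show ?case
        proof
          fix j assume "j \<in> insert i (underS r i)"
          then have "(j, i) \<in> r" using refl by (auto simp: underS_def)
          then have *: "|orb j (p j)| \<le>o |T i|"
            by (rule ordLeq_transitive[OF card_of_mono1[OF orb_mono] orb_le])
          show "|orb j (p j) \<union> inv (g i) ` orb j (p j)| \<le>o |T i|"
            by (rule card_of_Un_ordLeq_infinite[OF inf_T * ordLeq_transitive[OF card_of_image *]])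
        qed
      qed
      finally show ?thesis
        by (rule ordLeq_ordLess_trans[OF _ T_less])
    qed
  qed
qed

section \<open>Isometry invariance of Lebesgue measure\<close>

lemma Isom_image_cball:
  assumes "\<phi> \<in> Isom"
  shows "\<phi> ` cball a r = cball (\<phi> a) r"
proof
  show "cball (\<phi> a) r \<subseteq> \<phi> ` cball a r"
  proof
    fix y assume y: "y \<in> cball (\<phi> a) r"
    have "surj \<phi>" using assms by (simp add: Isom_def bij_is_surj)
    then obtain x where "y = \<phi> x" by (rule surjE)
    then show "y \<in> \<phi> ` cball a r" using y assms by (auto simp: Isom_def)
  qed
qed (use assms in \<open>auto simp: Isom_def\<close>)

lemma Isom_image_eq_vimage: "\<phi> \<in> Isom \<Longrightarrow> \<phi> ` S = inv \<phi> -` S"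
  unfolding Isom_def by (auto simp: bij_def surj_f_inv_f image_iff) (metis surj_f_inv_f)

lemma Isom_borel_measurable:
  fixes \<phi> :: "'a::euclidean_space \<Rightarrow> 'a"
  shows "\<phi> \<in> Isom \<Longrightarrow> \<phi> \<in> borel_measurable borel"
  by (rule borel_measurable_continuous_onI) (rule Isom_continuous_on)

lemma open_Isom_image:
  fixes U :: "'a::metric_space set"
  assumes "\<phi> \<in> Isom" "open U"
  shows "open (\<phi> ` U)"
  unfolding Isom_image_eq_vimage[OF assms(1)]
  by (rule open_vimage[OF assms(2) Isom_continuous_on[OF Isom_inv[OF assms(1)]]])

text \<open>By Vitali's theorem an open set is, up to a null set, a disjoint union of balls, and
  isometries preserve the volume of balls.\<close>

lemma emeasure_open_Isom_le:
  fixes U :: "'a::euclidean_space set"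
  assumes "\<phi> \<in> Isom" "open U"
  shows "emeasure lborel U \<le> emeasure lborel (\<phi> ` U)"
proof -
  let ?K = "{(a, r). 0 < r \<and> cball a r \<subseteq> U}"
  have fine: "\<exists>i\<in>?K. x \<in> cball (fst i) (snd i) \<and> snd i < d" if x: "x \<in> U" and d: "0 < d" for x d
  proof -
    obtain e where e: "0 < e" "cball x e \<subseteq> U"
      using assms(2) x open_contains_cball by blast
    have "(x, min e (d / 2)) \<in> ?K"
      using e d by (auto simp: subset_iff)
    then show ?thesis
      using e d by (force simp: min_def)
  qed
  obtain C where C: "countable C" "C \<subseteq> ?K"
    "pairwise (\<lambda>i j. disjnt (cball (fst i) (snd i)) (cball (fst j) (snd j))) C"
    "negligible (U - (\<Union>i\<in>C. cball (fst i) (snd i)))"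
  proof (rule Vitali_covering_theorem_cballs[of ?K snd U fst])
    show "0 < snd i" if "i \<in> ?K" for i using that by auto
    show "\<exists>i. i \<in> ?K \<and> x \<in> cball (fst i) (snd i) \<and> snd i < d" if "x \<in> U" "0 < d" for x d
      using fine[OF that] by blast
  qed
  let ?V = "\<Union>i\<in>C. cball (fst i) (snd i)"
  have disj: "disjoint_family_on (\<lambda>i. cball (fst i) (snd i)) C"
    using C(3) by (auto simp: disjoint_family_on_def pairwise_def disjnt_def)
  have "inj \<phi>" using assms(1) by (auto simp: Isom_def bij_def)
  then have disj': "disjoint_family_on (\<lambda>i. \<phi> ` cball (fst i) (snd i)) C"
    using disj by (auto simp: disjoint_family_on_def image_Int[symmetric])
  have sets: "?V \<in> sets borel"
    using C(1) by (intro sets.countable_UN') auto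
  have "U - ?V \<in> null_sets lborel"
    using C(4) assms(2) sets by (simp add: negligible_iff_null_sets null_sets_completion_iff)
  then have "emeasure lborel (?V \<union> (U - ?V)) = emeasure lborel ?V"
    using sets by (intro emeasure_Un_null_set) auto
  moreover have "emeasure lborel U \<le> emeasure lborel (?V \<union> (U - ?V))"
    using sets assms(2) by (intro emeasure_mono) auto
  ultimately have "emeasure lborel U \<le> emeasure lborel ?V" by simp
  also have "\<dots> = (\<integral>\<^sup>+i. emeasure lborel (cball (fst i) (snd i)) \<partial>count_space C)"
    using C(1) disj by (intro emeasure_UN_countable) auto
  also have "\<dots> = (\<integral>\<^sup>+i. emeasure lborel (\<phi> ` cball (fst i) (snd i)) \<partial>count_space C)"
    using C(2) by (intro nn_integral_cong)
      (auto simp: Isom_image_cball[OF assms(1)] emeasure_cball less_imp_le)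
  also have "\<dots> = emeasure lborel (\<Union>i\<in>C. \<phi> ` cball (fst i) (snd i))"
    using C(1) disj' by (intro emeasure_UN_countable[symmetric])
      (auto simp: Isom_image_cball[OF assms(1)])
  also have "\<dots> \<le> emeasure lborel (\<phi> ` U)"
  proof (rule emeasure_mono)
    show "(\<Union>i\<in>C. \<phi> ` cball (fst i) (snd i)) \<subseteq> \<phi> ` U"
      using C(2) by (intro UN_least image_mono) (fastforce simp del: mem_cball)
  qed (use open_Isom_image[OF assms] in simp)
  finally show ?thesis .
qed

text \<open>The inequality for \<open>\<phi>\<close> and for its inverse gives equality on open
  sets, which generate the Borel sets and are stable under intersection; balls of finite volume
  exhaust the space.\<close>

lemma lborel_distr_Isom:
  fixes \<phi> :: "'a::euclidean_space \<Rightarrow> 'a"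
  assumes "\<phi> \<in> Isom"
  shows "distr lborel lborel \<phi> = lborel"
proof (rule sym, rule measure_eqI_generator_eq[where E = "{U. open U}" and \<Omega> = UNIV])
  show "Int_stable {U :: 'a set. open U}" by (auto simp: Int_stable_def)
  show "sets (lborel :: 'a measure) = sigma_sets UNIV {U. open U}"
    by (simp add: borel_def)
  show "sets (distr lborel lborel \<phi>) = sigma_sets UNIV {U. open U}"
    by (simp add: borel_def)
  show "emeasure lborel X = emeasure (distr lborel lborel \<phi>) X" if "X \<in> {U. open U}" for X
  proof -
    have bij: "bij \<phi>" using assms by (simp add: Isom_def)
    have op: "open (inv \<phi> ` X)" using open_Isom_image[OF Isom_inv[OF assms]] that by auto
    have eq: "\<phi> ` inv \<phi> ` X = X" "inv \<phi> ` X = \<phi> -` X"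
      using bij by (auto simp: image_f_inv_f bij_def bij_vimage_eq_inv_image[OF bij])
    have "emeasure (distr lborel lborel \<phi>) X = emeasure lborel (inv \<phi> ` X)"
      using that Isom_borel_measurable[OF assms] by (subst emeasure_distr) (auto simp: eq)
    then show ?thesis
      using emeasure_open_Isom_le[OF assms op] emeasure_open_Isom_le[OF Isom_inv[OF assms], of X] that
      by (auto simp: eq(1) intro: antisym)
  qed
  show "range (\<lambda>n :: nat. ball (0 :: 'a) (real n)) \<subseteq> {U. open U}" by auto
  show "(\<Union>n :: nat. ball (0 :: 'a) (real n)) = UNIV"
    by (auto simp: dist_norm) (metis reals_Archimedean2)
  show "emeasure lborel (ball (0 :: 'a) (real n)) \<noteq> \<infinity>" for n :: nat
    by (simp add: emeasure_ball)
qed auto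

section \<open>Measures modulo an ideal\<close>

text \<open>A set is measured by any \<open>B\<close> whose preimage under \<open>T\<close> equals
  it modulo \<open>I\<close>. Two such \<open>B\<close> differ by sets whose preimages lie in
  \<open>I\<close>, hence by null sets, so the choice in \<open>\<mu>\<close> does not
  matter.\<close>

lemma measure_modulo_ideal:
  fixes T :: "'a \<Rightarrow> 'b" and N :: "'b measure" and I :: "'a set set"
  assumes T: "\<And>x. T x \<in> space N"
    and I_subset: "\<And>A B. A \<in> I \<Longrightarrow> B \<subseteq> A \<Longrightarrow> B \<in> I"
    and I_UN: "\<And>A :: nat \<Rightarrow> 'a set. (\<And>n. A n \<in> I) \<Longrightarrow> (\<Union>n. A n) \<in> I"
    and empty: "{} \<in> I"
    and null: "\<And>B. B \<in> sets N \<Longrightarrow> T -` B \<in> I \<Longrightarrow> emeasure N B = 0"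
  obtains M where "space M = UNIV"
    "sets M = {E. \<exists>B\<in>sets N. sym_diff E (T -` B) \<in> I}"
    "\<And>E B. B \<in> sets N \<Longrightarrow> sym_diff E (T -` B) \<in> I \<Longrightarrow> emeasure M E = emeasure N B"
proof -
  define rep where "rep E B \<longleftrightarrow> B \<in> sets N \<and> sym_diff E (T -` B) \<in> I" for E B
  define \<A> where "\<A> = {E. \<exists>B. rep E B}"
  define \<mu> where "\<mu> E = emeasure N (SOME B. rep E B)" for E
  have I_Un: "A \<union> B \<in> I" if "A \<in> I" "B \<in> I" for A B
  proof -
    have "(\<Union>n :: nat. if n = 0 then A else B) \<in> I"
      by (rule I_UN) (use that in auto)
    then show ?thesis by (rule I_subset) (auto split: if_splits)
  qed
  have null_diff: "emeasure N (B - B') = 0" if "rep E B" "rep E B'" for E B B'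
  proof (rule null)
    show "B - B' \<in> sets N" using that by (auto simp: rep_def)
    have "sym_diff E (T -` B) \<union> sym_diff E (T -` B') \<in> I"
      by (rule I_Un) (use that in \<open>auto simp: rep_def\<close>)
    then show "T -` (B - B') \<in> I"
      by (rule I_subset) auto
  qed
  have le: "emeasure N B \<le> emeasure N B'" if "rep E B" "rep E B'" for E B B'
  proof -
    have "emeasure N B \<le> emeasure N (B' \<union> (B - B'))"
      using that by (intro emeasure_mono) (auto simp: rep_def)
    also have "\<dots> \<le> emeasure N B' + emeasure N (B - B')"
      using that by (intro emeasure_subadditive) (auto simp: rep_def)
    finally show ?thesis using null_diff[OF that] by simp
  qed
  have \<mu>_eq: "\<mu> E = emeasure N B" if "rep E B" for E B
    unfolding \<mu>_def using someI[of "rep E", OF that] le that by (metis antisym)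
  have rep_UN: "rep (\<Union>n. E n) (\<Union>n. B n)" if "\<And>n. rep (E n) (B n)"
    for E and B :: "nat \<Rightarrow> 'b set"
  proof -
    have "(\<Union>n. sym_diff (E n) (T -` B n)) \<in> I"
      using that by (intro I_UN) (simp add: rep_def)
    then have "sym_diff (\<Union>n. E n) (T -` (\<Union>n. B n)) \<in> I"
      by (rule I_subset) auto
    then show ?thesis using that by (auto simp: rep_def)
  qed
  have rep_Compl: "rep (- E) (space N - B)" if "rep E B" for E B
  proof -
    have "sym_diff (- E) (T -` (space N - B)) = sym_diff E (T -` B)"
      using T by auto
    moreover have "space N - B \<in> sets N"
      using that by (auto simp: rep_def)
    ultimately show ?thesis using that by (simp add: rep_def)
  qed
  have alg: "sigma_algebra UNIV \<A>"
    unfolding sigma_algebra_iff2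
  proof (intro conjI ballI allI impI)
    have "rep {} {}" using empty by (simp add: rep_def)
    then show "{} \<in> \<A>" unfolding \<A>_def by blast
    show "UNIV - E \<in> \<A>" if "E \<in> \<A>" for E
      using that rep_Compl unfolding \<A>_def by (auto simp: Compl_eq_Diff_UNIV)
    show "(\<Union>n. E n) \<in> \<A>" if "range E \<subseteq> \<A>" for E :: "nat \<Rightarrow> 'a set"
    proof -
      have "\<forall>n. \<exists>B. rep (E n) B" using that unfolding \<A>_def by blast
      then obtain B where "\<And>n. rep (E n) (B n)" by metis
      then show ?thesis using rep_UN unfolding \<A>_def by blast
    qed
  qed auto
  have "countably_additive \<A> \<mu>"
    unfolding countably_additive_def
  proof (intro allI impI)
    fix E :: "nat \<Rightarrow> 'a set"
    assume E: "range E \<subseteq> \<A>" "disjoint_family E" "(\<Union>n. E n) \<in> \<A>"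
    have "\<forall>n. \<exists>B. rep (E n) B" using E(1) unfolding \<A>_def by blast
    then obtain B where B: "\<And>n. rep (E n) (B n)" by metis
    \<comment> \<open>Representatives of disjoint sets may overlap. As the \<open>E n\<close> are
      disjoint, the preimage of an overlap lies in the exceptional sets, so the disjointed family
      still represents them.\<close>
    have "rep (E n) (disjointed B n)" for n
    proof -
      have "(\<Union>n. sym_diff (E n) (T -` B n)) \<in> I"
        using B by (intro I_UN) (simp add: rep_def)
      moreover have "sym_diff (E n) (T -` disjointed B n) \<subseteq> (\<Union>n. sym_diff (E n) (T -` B n))"
      proof
        fix x assume x: "x \<in> sym_diff (E n) (T -` disjointed B n)"
        show "x \<in> (\<Union>n. sym_diff (E n) (T -` B n))"
        proof (cases "x \<in> sym_diff (E n) (T -` B n)")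
          case False
          then obtain i where "i < n" "x \<in> E n" "x \<in> T -` B i"
            using x by (auto simp: disjointed_def)
          moreover have "x \<notin> E i"
            using disjoint_family_onD[OF E(2), of i n] calculation by auto
          ultimately show ?thesis by blast
        qed blast
      qed
      moreover have "disjointed B n \<in> sets N"
        using B by (auto simp: rep_def disjointed_def)
      ultimately show ?thesis
        using I_subset unfolding rep_def by blast
    qed
    note D = this
    have "(\<Sum>n. \<mu> (E n)) = (\<Sum>n. emeasure N (disjointed B n))"
      using \<mu>_eq[OF D] by simp
    also have "\<dots> = emeasure N (\<Union>n. disjointed B n)"
      using D by (intro suminf_emeasure disjoint_family_disjointed) (auto simp: rep_def)
    also have "\<dots> = \<mu> (\<Union>n. E n)"
      using \<mu>_eq[OF rep_UN[OF D]] by simp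
    finally show "(\<Sum>n. \<mu> (E n)) = \<mu> (\<Union>n. E n)" .
  qed
  moreover have "positive \<A> \<mu>"
    using \<mu>_eq[of "{}" "{}"] empty by (simp add: positive_def rep_def)
  ultimately have "measure_space UNIV \<A> \<mu>"
    using alg by (simp add: measure_space_def)
  then have *: "space (measure_of UNIV \<A> \<mu>) = UNIV" "sets (measure_of UNIV \<A> \<mu>) = \<A>"
    "\<And>E. E \<in> \<A> \<Longrightarrow> emeasure (measure_of UNIV \<A> \<mu>) E = \<mu> E"
    using sigma_algebra.sets_measure_of_eq[OF alg] emeasure_measure_of_sigma[OF alg]
    by (auto simp: measure_space_def)
  show thesis
  proof (rule that[of "measure_of UNIV \<A> \<mu>"])
    show "sets (measure_of UNIV \<A> \<mu>) = {E. \<exists>B\<in>sets N. sym_diff E (T -` B) \<in> I}"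
      using *(2) unfolding \<A>_def rep_def by auto
    show "emeasure (measure_of UNIV \<A> \<mu>) E = emeasure N B"
      if "B \<in> sets N" "sym_diff E (T -` B) \<in> I" for E B
      using *(3)[of E] \<mu>_eq[of E B] that unfolding \<A>_def rep_def by auto
  qed (rule *(1))
qed

section \<open>The invariant measure\<close>

lemma Bernstein_Isom_colouring:
  obtains f :: "'a::euclidean_space \<Rightarrow> nat"
  where "\<And>\<phi>. \<phi> \<in> Isom \<Longrightarrow> small {x. f (\<phi> x) \<noteq> f x}"
    "\<And>K n. closed K \<Longrightarrow> uncountable K \<Longrightarrow> \<not> small {x \<in> K. f x = n}"
proof -
  let ?\<K> = "{K :: 'a set. closed K \<and> uncountable K}"
  \<comment> \<open>The third component is a dummy: it requests each pair of a closed set and a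
    colour continuum many times.\<close>
  let ?P = "?\<K> \<times> (UNIV :: nat set) \<times> (UNIV :: nat set set)"
  have "id \<in> (Isom :: ('a \<Rightarrow> 'a) set)" by (simp add: Isom_def)
  then obtain g :: "nat set \<Rightarrow> 'a \<Rightarrow> 'a" where g: "range g = Isom"
    using card_of_Isom card_of_ordLeq2[of "Isom :: ('a \<Rightarrow> 'a) set" "UNIV :: nat set set"]
    by blast
  have "uncountable (UNIV :: 'a set)"
    using countable_subset[OF subset_UNIV] uncountable_ball[of 1 "0 :: 'a"] by auto
  then have ne: "?P \<noteq> {}" by auto
  have "|?\<K>| \<le>o |UNIV :: nat set set|"
    using ordLeq_transitive[OF card_of_mono1[of ?\<K> "{K. closed K}"] card_of_closed_sets] by blast
  moreover have "|UNIV :: nat set| \<le>o |UNIV :: nat set set|"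
    using infinite_nat_set infinite_iff_card_of_nat by blast
  moreover have "|UNIV :: nat set set| \<le>o |UNIV :: nat set set|"
    by (rule card_of_mono1) simp
  ultimately have "|?P| \<le>o |UNIV :: nat set set|"
    by (intro card_of_Sigma_ordLeq_infinite[OF infinite_nat_set] ballI)
  then obtain s :: "nat set \<Rightarrow> 'a set \<times> nat \<times> nat set" where s: "range s = ?P"
    using card_of_ordLeq2[OF ne, of "UNIV :: nat set set"] by blast
  have unc: "uncountable (UNIV :: nat set set)"
    using countable_eqpoll[OF _ eqpoll_sym[OF nat_sets_eqpoll_reals]] uncountable_UNIV_real
    by blast
  have bij: "bij (g i)" for i
    using g by (auto simp: Isom_def)
  have card_K: "|UNIV :: nat set set| \<le>o |fst (s j)|" for j
  proof (rule card_of_uncountable_closed)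
    have "s j \<in> ?P" using s by blast
    then show "closed (fst (s j))" "uncountable (fst (s j))" by auto
  qed
  obtain f p where p: "inj p" "\<And>j. p j \<in> fst (s j)" "\<And>j. f (p j) = fst (snd (s j))"
    and f: "\<And>i. small {x. f (g i x) \<noteq> f x}"
    by (rule invariant_colouring[where g = g and K = "\<lambda>j. fst (s j)" and
          col = "\<lambda>j. fst (snd (s j))", OF unc bij card_K]) (rule that)
  show thesis
  proof
    show "small {x. f (\<phi> x) \<noteq> f x}" if \<phi>: "\<phi> \<in> Isom" for \<phi>
    proof -
      obtain i where "\<phi> = g i" using g \<phi> by (metis rangeE)
      then show ?thesis using f[of i] by simp
    qed
    show "\<not> small {x \<in> K. f x = n}" if K: "closed K" "uncountable K" for K n
    proof
      \<comment> \<open>\<open>?h\<close> reads the dummy component of the request that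
        \<open>x\<close> answers. The answers to \<open>(K, n, Y)\<close> for all \<open>Y\<close>
        make it surjective.\<close>
      let ?h = "\<lambda>x. snd (snd (s (inv p x)))"
      assume "small {x \<in> K. f x = n}"
      then have "small (?h ` {x \<in> K. f x = n})" by (rule small_image)
      moreover have "?h ` {x \<in> K. f x = n} = UNIV"
      proof -
        have "Y \<in> ?h ` {x \<in> K. f x = n}" for Y
        proof -
          have "(K, n, Y) \<in> range s" using K s by auto
          then obtain j where "s j = (K, n, Y)" by (metis rangeE)
          then show ?thesis
            using p(2,3)[of j] p(1) by (intro image_eqI[of _ _ "p j"]) auto
        qed
        then show ?thesis by blast
      qed
      ultimately have "small (UNIV :: nat set set)" by simp
      then show False by (rule notE[OF ordLess_irreflexive])
    qed
  qed
qed

text \<open>Inner regularity gives a closed subset missing less than the measure of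
  \<open>S\<close>; it is not null, hence not countable.\<close>

lemma uncountable_closed_subset_of_pos_measure:
  fixes S :: "'a::euclidean_space set"
  assumes "S \<in> sets borel" "emeasure lborel S \<noteq> 0"
  obtains K where "closed K" "uncountable K" "K \<subseteq> S"
proof -
  \<comment> \<open>A finite bound even for infinite measure: \<open>e\<close> is the measure of
    \<open>S\<close> if that is finite, and 1 otherwise.\<close>
  obtain e where e: "0 < e" "ennreal e \<le> emeasure lborel S"
  proof (cases "emeasure lborel S")
    case (real r)
    then show thesis using assms(2) that[of r] by (cases "r = 0") auto
  next
    case top
    then show thesis using that[of 1] by simp
  qed
  have "S \<in> sets lebesgue" using assms(1) by simp
  then obtain K where K: "closed K" "K \<subseteq> S" "emeasure lebesgue (S - K) < ennreal e"
    using sets_lebesgue_inner_closed[of S e] e(1) by metis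
  have "uncountable K"
  proof
    assume "countable K"
    then have "emeasure lborel K = 0" by (rule emeasure_lborel_countable)
    moreover have "emeasure lborel S \<le> emeasure lborel K + emeasure lborel (S - K)"
      using assms(1) K(1,2) emeasure_subadditive[of K lborel "S - K"]
      by (simp add: Un_absorb1)
    moreover have "emeasure lborel (S - K) < ennreal e"
      using K(1,3) assms(1) by simp
    ultimately show False using e(2) by (simp add: not_less[symmetric])
  qed
  with K that show thesis by blast
qed

theorem corollary1p4:
  shows "\<exists>\<A> :: (real ^ 'n::finite) set set.
    sigma_algebra UNIV \<A> \<and> isometry_invariant_sets \<A> \<and> sets borel \<subseteq> \<A> \<and>
    (\<exists>\<mu>. space \<mu> = UNIV \<and> sets \<mu> = \<A> \<and>
      isometry_invariant_measure \<mu> \<and> sigma_finite_measure \<mu> \<and>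
      \<not> sigma_finite_measure (restr_to_subalg \<mu> borel))"
proof -
  obtain f :: "real ^ 'n \<Rightarrow> nat"
    where f_inv: "\<And>\<phi>. \<phi> \<in> Isom \<Longrightarrow> small {x. f (\<phi> x) \<noteq> f x}"
      and f_meets: "\<And>K n. closed K \<Longrightarrow> uncountable K \<Longrightarrow> \<not> small {x \<in> K. f x = n}"
    using Bernstein_Isom_colouring by blast
  \<comment> \<open>\<open>N\<close> consists of countably many copies of Lebesgue measure and
    \<open>T\<close> sends \<open>x\<close> to the copy of its colour. The preimage of
    \<open>B\<close> thus agrees with the \<open>n\<close>-th slice of \<open>B\<close> on colour
    class \<open>n\<close>.\<close>
  define T where "T x = (f x, x)" for x
  define N :: "(nat \<times> (real ^ 'n)) measure" where "N = count_space UNIV \<Otimes>\<^sub>M lborel"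
  have [measurable_cong]: "sets N = sets (count_space UNIV \<Otimes>\<^sub>M lborel)"
    unfolding N_def by simp
  have space_N: "space N = UNIV"
    unfolding N_def by (simp add: space_pair_measure)
  interpret count: sigma_finite_measure "count_space (UNIV :: nat set)"
    by (rule sigma_finite_measure_count_space)
  interpret pair_sigma_finite "count_space (UNIV :: nat set)" "lborel :: (real ^ 'n) measure" ..
  have slice: "Pair n -` B \<in> sets borel" if "B \<in> sets N" for n B
    using sets_Pair1[of B "count_space UNIV" lborel n] that by (simp add: N_def)
  have N_eq: "emeasure N B = (\<integral>\<^sup>+n. emeasure lborel (Pair n -` B) \<partial>count_space UNIV)"
    if "B \<in> sets N" for B
    using that unfolding N_def by (rule lborel.emeasure_pair_measure_alt)
  have null: "emeasure N B = 0" if B: "B \<in> sets N" "small (T -` B)" for B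
  proof -
    \<comment> \<open>A slice of positive measure contains an uncountable closed set, whose points
      of colour \<open>n\<close> all lie in the preimage of \<open>B\<close> and are too
      many.\<close>
    have "emeasure lborel (Pair n -` B) = 0" for n
    proof (rule ccontr)
      assume "emeasure lborel (Pair n -` B) \<noteq> 0"
      then obtain K where K: "closed K" "uncountable K" "K \<subseteq> Pair n -` B"
        using uncountable_closed_subset_of_pos_measure[OF slice[OF B(1)]] by metis
      then have "{x \<in> K. f x = n} \<subseteq> T -` B" by (auto simp: T_def)
      then show False using small_subset[OF B(2)] f_meets[OF K(1,2)] by blast
    qed
    then show ?thesis using N_eq[OF B(1)] by simp
  qed
  obtain M where M: "space M = UNIV"
    "sets M = {E. \<exists>B\<in>sets N. sym_diff E (T -` B) \<in> Collect small}"
    "\<And>E B. B \<in> sets N \<Longrightarrow> sym_diff E (T -` B) \<in> Collect small \<Longrightarrow> emeasure M E = emeasure N B"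
  proof (rule measure_modulo_ideal[of T N "Collect small"])
    show "(\<Union>n. A n) \<in> Collect small"
      if "\<And>n. A n \<in> Collect small" for A :: "nat \<Rightarrow> (real ^ 'n) set"
      using small_UN_nat[of A] that by simp
  qed (use null small_empty small_subset space_N in auto)
  have cyl: "UNIV \<times> B \<in> sets N" "sym_diff B (T -` (UNIV \<times> B)) \<in> Collect small"
    if "B \<in> sets borel" for B
  proof -
    have "T -` (UNIV \<times> B) = B" by (auto simp: T_def)
    then show "sym_diff B (T -` (UNIV \<times> B)) \<in> Collect small"
      using small_empty by simp
  qed (use that in \<open>simp add: N_def\<close>)
  have borel: "sets borel \<subseteq> sets M"
    unfolding M(2) using cyl by blast
  \<comment> \<open>A Borel set is represented by the same set in every copy. With \<infinity> * 0 =
    0, Borel sets have measure 0 or \<infinity> only.\<close>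
  have M_borel: "emeasure M B = \<infinity> * emeasure lborel B" if "B \<in> sets borel" for B
  proof -
    have "emeasure M B = emeasure N (UNIV \<times> B)"
      by (rule M(3)) (use cyl that in auto)
    also have "\<dots> = emeasure (count_space (UNIV :: nat set)) UNIV * emeasure lborel B"
      unfolding N_def using that by (intro lborel.emeasure_pair_measure_Times) auto
    finally show ?thesis by simp
  qed
  have inv: "\<phi> ` E \<in> sets M \<and> emeasure M (\<phi> ` E) = emeasure M E"
    if E: "E \<in> sets M" and \<phi>: "\<phi> \<in> Isom" for E \<phi>
  proof -
    obtain B where B: "B \<in> sets N" "small (sym_diff E (T -` B))"
      using E unfolding M(2) by blast
    \<comment> \<open>Taking preimages under \<open>F\<close> applies \<open>\<phi>\<close> to every
      slice and keeps the colour index.\<close>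
    define F where "F = (\<lambda>(n :: nat, y). (n, inv \<phi> y))"
    have meas: "inv \<phi> \<in> measurable lborel lborel"
      using Isom_borel_measurable[OF Isom_inv[OF \<phi>]] by simp
    have F_meas: "F \<in> measurable N N"
      unfolding F_def N_def using meas by measurable
    have "distr (count_space UNIV) (count_space UNIV) (\<lambda>n. n) \<Otimes>\<^sub>M distr lborel lborel (inv \<phi>)
        = distr (count_space (UNIV :: nat set) \<Otimes>\<^sub>M lborel) (count_space UNIV \<Otimes>\<^sub>M lborel) F"
      unfolding F_def
      by (rule pair_measure_distr)
        (use meas lborel_distr_Isom[OF Isom_inv[OF \<phi>]] lborel.sigma_finite_measure_axioms in auto)
    then have distr: "distr N N F = N"
      unfolding N_def lborel_distr_Isom[OF Isom_inv[OF \<phi>]] by (simp add: distr_id2)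
    have B': "F -` B \<in> sets N"
      using measurable_sets[OF F_meas B(1)] space_N by simp
    have "emeasure N (F -` B) = emeasure N B"
      using emeasure_distr[OF F_meas B(1)] distr space_N by simp
    moreover have "sym_diff (\<phi> ` E) (T -` F -` B) \<in> Collect small"
    proof -
      have inv: "inv \<phi> (\<phi> x) = x" "\<phi> (inv \<phi> x) = x" for x
        using \<phi> by (simp_all add: Isom_def bij_def surj_f_inv_f)
      \<comment> \<open>The slice is chosen by the colour of \<open>y\<close> on one side and of
        \<open>inv \<phi> y\<close> on the other, so a new discrepancy needs a change of
        colour.\<close>
      have "sym_diff (\<phi> ` E) (T -` F -` B)
          \<subseteq> \<phi> ` sym_diff E (T -` B) \<union> {y. f (inv \<phi> y) \<noteq> f y}"
      proof
        fix y assume y: "y \<in> sym_diff (\<phi> ` E) (T -` F -` B)"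
        have "y \<in> \<phi> ` A \<longleftrightarrow> inv \<phi> y \<in> A" for A
          using inv by (metis image_iff)
        then show "y \<in> \<phi> ` sym_diff E (T -` B) \<union> {y. f (inv \<phi> y) \<noteq> f y}"
          using y by (auto simp: T_def F_def)
      qed
      then show ?thesis
        using small_subset small_Un[OF small_image[OF B(2)] f_inv[OF Isom_inv[OF \<phi>]]] by blast
    qed
    moreover have "emeasure M E = emeasure N B"
      by (rule M(3)) (use B in auto)
    ultimately show ?thesis
      using B' M(3)[of "F -` B" "\<phi> ` E"] unfolding M(2) by auto
  qed
  have "sigma_finite_measure M"
  proof -
    obtain A :: "nat \<Rightarrow> _" where A: "range A \<subseteq> sets N" "(\<Union>i. A i) = space N"
      "\<And>i. emeasure N (A i) \<noteq> \<infinity>"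
      using sigma_finite unfolding N_def by metis
    have "sym_diff (T -` A i) (T -` A i) \<in> Collect small" "A i \<in> sets N" for i
      using A(1) small_empty by auto
    then have "T -` A i \<in> sets M" "emeasure M (T -` A i) \<noteq> \<infinity>" for i
      using A(3) M(3)[of "A i" "T -` A i"] unfolding M(2) by (blast, metis)
    moreover have "(\<Union>i. T -` A i) = space M"
      using A(2) space_N M(1) by (simp flip: vimage_UN)
    ultimately show ?thesis
      by (intro sigma_finite_measure.intro exI[of _ "range (\<lambda>i. T -` A i)"]) auto
  qed
  moreover have "\<not> sigma_finite_measure (restr_to_subalg M borel)"
  proof
    assume "sigma_finite_measure (restr_to_subalg M borel)"
    have sub: "subalgebra M borel"
      using borel M(1) by (simp add: subalgebra_def)
    obtain C :: "nat \<Rightarrow> _" where C: "range C \<subseteq> sets (restr_to_subalg M borel)"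
      "(\<Union>i. C i) = space (restr_to_subalg M borel)"
      "\<And>i. emeasure (restr_to_subalg M borel) (C i) \<noteq> \<infinity>"
      using sigma_finite_measure.sigma_finite[OF \<open>sigma_finite_measure (restr_to_subalg M borel)\<close>]
      by metis
    have C_borel: "C i \<in> sets borel" for i
      using C(1) sets_restr_to_subalg[OF sub] by auto
    \<comment> \<open>Finite measure forces each Borel set \<open>C i\<close> to be Lebesgue null,
      so they cannot cover the space.\<close>
    have "emeasure lborel (C i) = 0" for i
    proof (rule ccontr)
      assume "emeasure lborel (C i) \<noteq> 0"
      then have "emeasure M (C i) = \<infinity>"
        using M_borel[OF C_borel] by (simp add: ennreal_top_mult)
      then show False
        using C(3)[of i] emeasure_restr_to_subalg[OF sub C_borel] by simp
    qed
    then have "(\<Union>i. C i) \<in> null_sets lborel"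
      using C_borel by (intro null_sets_UN) auto
    then show False
      using C(2) M(1) by (simp add: space_restr_to_subalg null_sets_def)
  qed
  moreover have "sigma_algebra UNIV (sets M)"
    using sets.sigma_algebra_axioms[of M] M(1) by simp
  moreover have "isometry_invariant_sets (sets M)" "isometry_invariant_measure M"
    using inv by (auto simp: isometry_invariant_sets_def isometry_invariant_measure_def)
  ultimately show ?thesis
    using borel M(1) by blast
qed

end
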